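(* Let $dc_r(n,k)$ be the number of $k$-compositions of $n$ with exactly $r$ descents and let $dc_r(n)$ be the number of compositions of $n$ (into any number of parts) with exactly $r$ descents. Let $$DC_t(q,k)=\sum_{n\geq0}\sum_{r\geq0}dc_r(n,k)q^nt^r,\qquad DC_t(q)=\sum_{n\geq0}\sum_{r\geq0}dc_r(n)q^nt^r.$$ Then $DC_t(q,0)=1$ and, for every $k\geq1$, $$DC_t(q,k)=\frac{q^k}{(q)_k}\sum_{\lambda\vdash k}t^{l(\lambda)-1}(1-t)^{k-l(\lambda)}g^\lambda(q).$$ Moreover, $$DC_t(q)=1+\sum_{\mu}\frac{q^{|\mu|}}{(q)_{|\mu|}}t^{l(\mu)-1}(1-t)^{|\mu|-l(\mu)}g^\mu(q)=\frac{1-t}{\sum_{j\geq0}q^{\binom{j+1}{2}}\frac{(t-1)^j}{(q)_j}-t},$$ where $\mu$ runs through all integer partitions except the empty partition.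
   Context: The identities are between formal power series in $q$ with coefficients in $\mathbb{Z}[t]$; the last quotient is taken in $\mathbb{Q}(t)[[q]]$, where its denominator has invertible constant term $1-t$. A $k$-composition of $n$ is an ordered $k$-tuple $(\sigma_1,\ldots,\sigma_k)$ of positive integers with sum $n$; the empty tuple is the unique $0$-composition, and it is a composition of $0$. A descent of $\sigma$ is an index $i$ with $1\le i<k$ and $\sigma_i>\sigma_{i+1}$. A partition $\lambda$ of $n$ (written $\lambda\vdash n$, $|\lambda|=n$) is a weakly decreasing tuple of positive integers with sum $n$; $l(\lambda)$ is its number of parts, and $m_i^\lambda$ is the number of parts of $\lambda$ equal to $i$. Notation: $[n]_q=1+q+\cdots+q^{n-1}$; $[n]_q!=[n]_q[n-1]_q\cdots[1]_q$, $[0]_q!=1$; $(q)_n=(1-q)(1-q^2)\cdots(1-q^n)$, $(q)_0=1$; and $$g^\lambda(q)=\frac{l(\lambda)!\,[n]_q!}{\prod_{i}m_i^\lambda!\,([i]_q!)^{m_i^\lambda}},\qquad n=|\lambda|,$$ where the product is over all $i\ge1$. *)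

theory Defs
  imports
    "HOL-Computational_Algebra.Computational_Algebra"
    "HOL-Analysis.Infinite_Sum"
begin

definition compositions :: "nat \<Rightarrow> nat list set" where
  "compositions n = {\<sigma>. (\<forall>x\<in>set \<sigma>. x > 0) \<and> sum_list \<sigma> = n}"

(* 0-based: the index i below is the index i + 1 of the usual convention 1 \<le> i < k. *)
definition descents :: "nat list \<Rightarrow> nat set" where
  "descents \<sigma> = {i. Suc i < length \<sigma> \<and> \<sigma> ! i > \<sigma> ! Suc i}"

definition dc_parts :: "nat \<Rightarrow> nat \<Rightarrow> nat \<Rightarrow> nat" where
  "dc_parts r n k = card {\<sigma> \<in> compositions n. length \<sigma> = k \<and> card (descents \<sigma>) = r}"

definition dc :: "nat \<Rightarrow> nat \<Rightarrow> nat" where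
  "dc r n = card {\<sigma> \<in> compositions n. card (descents \<sigma>) = r}"

(* Z[t][[q]] is the type int poly fps: t is the polynomial variable and q is fps_X.
   A composition of n has at most n parts, hence at most n descents, so the sum over r can be
   cut off at n; see coeff_DC_parts and coeff_DC. *)
definition DC_parts :: "nat \<Rightarrow> int poly fps" where
  "DC_parts k = Abs_fps (\<lambda>n. \<Sum>r\<le>n. monom (int (dc_parts r n k)) r)"

definition DC :: "int poly fps" where
  "DC = Abs_fps (\<lambda>n. \<Sum>r\<le>n. monom (int (dc r n)) r)"

(* The fraction field of Z[t] is Q(t); all quotients are taken in Q(t)[[q]]. *)
type_synonym Qt = "int poly fract"

definition embed_Qt :: "int poly fps \<Rightarrow> Qt fps" where
  "embed_Qt F = Abs_fps (\<lambda>n. to_fract (fps_nth F n))"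

definition tvar :: "Qt fps" where
  "tvar = fps_const (to_fract [:0, 1:])"

abbreviation qvar :: "Qt fps" where
  "qvar \<equiv> fps_X"

definition is_partition :: "nat list \<Rightarrow> bool" where
  "is_partition lam \<longleftrightarrow> sorted_wrt (\<ge>) lam \<and> (\<forall>x\<in>set lam. x > 0)"

definition q_int :: "nat \<Rightarrow> Qt fps" where
  "q_int n = (\<Sum>i<n. qvar ^ i)"

definition q_fact :: "nat \<Rightarrow> Qt fps" where
  "q_fact n = (\<Prod>i=1..n. q_int i)"

definition q_poch :: "nat \<Rightarrow> Qt fps" where
  "q_poch n = (\<Prod>i=1..n. 1 - qvar ^ i)"

(* The factors with i > |lam| are 1.  The denominator has a nonzero rational constant term, so the
   quotient is the usual one. *)
definition g_part :: "nat list \<Rightarrow> Qt fps" where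
  "g_part lam =
     fact (length lam) * q_fact (sum_list lam)
     / (\<Prod>i=1..sum_list lam. fact (count_list lam i) * q_fact i ^ count_list lam i)"

lemma length_le_sum_list:
  fixes xs :: "nat list"
  assumes "\<forall>x\<in>set xs. x > 0"
  shows "length xs \<le> sum_list xs"
  using assms by (induction xs) auto

lemma finite_positive_lists: "finite {xs :: nat list. (\<forall>x\<in>set xs. x > 0) \<and> sum_list xs = n}"
proof (rule finite_subset)
  show "{xs :: nat list. (\<forall>x\<in>set xs. x > 0) \<and> sum_list xs = n}
          \<subseteq> {xs. set xs \<subseteq> {..n} \<and> length xs \<le> n}"
    using length_le_sum_list member_le_sum_list by fastforce
  show "finite {xs :: nat list. set xs \<subseteq> {..n} \<and> length xs \<le> n}"
    by (rule finite_lists_length_le) simp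
qed

lemma finite_compositions: "finite (compositions n)"
  unfolding compositions_def by (rule finite_positive_lists)

lemma finite_partitions: "finite {lam. is_partition lam \<and> sum_list lam = k}"
  by (rule finite_subset[OF _ finite_positive_lists[of k]]) (auto simp: is_partition_def)

lemma card_descents_le:
  assumes "\<sigma> \<in> compositions n"
  shows "card (descents \<sigma>) \<le> n"
proof -
  have "card (descents \<sigma>) \<le> card {..<length \<sigma>}"
    by (rule card_mono) (auto simp: descents_def)
  also have "\<dots> \<le> n"
    using assms length_le_sum_list by (auto simp: compositions_def)
  finally show ?thesis .
qed

lemma coeff_DC_parts: "coeff (fps_nth (DC_parts k) n) r = int (dc_parts r n k)"
proof -
  have "dc_parts r n k = 0" if "\<not> r \<le> n"
  proof -
    have "{\<sigma> \<in> compositions n. length \<sigma> = k \<and> card (descents \<sigma>) = r} = {}"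
      using that card_descents_le by auto
    then show ?thesis
      unfolding dc_parts_def by (metis card.empty)
  qed
  then show ?thesis
    by (auto simp: DC_parts_def coeff_sum)
qed

lemma coeff_DC: "coeff (fps_nth DC n) r = int (dc r n)"
proof -
  have "dc r n = 0" if "\<not> r \<le> n"
  proof -
    have "{\<sigma> \<in> compositions n. card (descents \<sigma>) = r} = {}"
      using that card_descents_le by auto
    then show ?thesis
      unfolding dc_def by (metis card.empty)
  qed
  then show ?thesis
    by (auto simp: DC_def coeff_sum)
qed

end

theory Submission
  imports Defs "HOL-Combinatorics.Multiset_Permutations"
begin

text \<open>
  A non-descent has weight \<open>1 = t + (1 - t)\<close>. Expanding this at every non-descent cuts a composition
  into weakly increasing blocks: every cut has weight \<open>t\<close>, every uncut position weight \<open>1 - t\<close>. The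
  weakly increasing \<open>a\<close>-compositions have the generating function \<open>h\<^sub>a = q\<^sup>a / (q)\<^sub>a\<close>, so
  \<open>DC\<^sub>t(q,k)\<close> is the sum of \<open>t\<^bsup>l - 1\<^esup> (1 - t)\<^bsup>k - l\<^esup> h\<^bsub>a\<^sub>1\<^esub> \<dots> h\<^bsub>a\<^sub>l\<^esub>\<close> over the compositions of \<open>k\<close>,
  and collecting the rearrangements of each partition gives the factors \<open>g\<^sup>\<lambda>\<close>. Summing the geometric
  series over \<open>l\<close> gives \<open>(1 - t) H / (1 - t H)\<close> with \<open>H = \<Sum>\<^sub>a (1 - t)\<^sup>a h\<^sub>a\<close>, and \<open>1 / H\<close> is
  Euler's series.
\<close>

section \<open>Descents and the first block of a composition\<close>

lemma card_descents_Cons_Cons: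
  "card (descents (x # y # ys)) = of_bool (y < x) + card (descents (y # ys))"
proof -
  have "descents (x # y # ys) = (if y < x then {0} else {}) \<union> Suc ` descents (y # ys)"
  proof (rule set_eqI)
    fix i show "i \<in> descents (x # y # ys) \<longleftrightarrow>
        i \<in> (if y < x then {0} else {}) \<union> Suc ` descents (y # ys)"
      by (cases i) (auto simp: descents_def)
  qed
  moreover have "finite (descents (y # ys))"
    by (rule finite_subset[of _ "{..<length (y # ys)}"]) (auto simp: descents_def)
  ultimately show ?thesis
    by (auto simp: card_image)
qed

lemma descents_short: "length \<sigma> \<le> 1 \<Longrightarrow> descents \<sigma> = {}"
  by (auto simp: descents_def)

text \<open>The weight of what follows a block: an empty remainder needs no cut, hence the value
  1.\<close>

definition tail_weight :: "'a::comm_ring_1 \<Rightarrow> nat list \<Rightarrow> 'a" where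
  "tail_weight x \<sigma> = (if \<sigma> = [] then 1 else x * x ^ card (descents \<sigma>))"

text \<open>Here \<open>a + 1\<close> is the length of the first block; the factor \<open>x\<close> in \<^const>\<open>tail_weight\<close> belongs to
  the cut that follows it.\<close>

lemma power_card_descents_block:
  assumes "\<sigma> \<noteq> []"
  shows "x ^ card (descents \<sigma>) =
    (\<Sum>a<length \<sigma>. (1 - x) ^ a *
       (of_bool (sorted (take (Suc a) \<sigma>)) * tail_weight x (drop (Suc a) \<sigma>)))"
  using assms
proof (induction \<sigma> rule: induct_list012)
  case (3 a b \<sigma>)
  \<comment> \<open>For \<open>i = 0\<close> the block is \<open>a\<close> alone, and the cut after
    it has weight \<open>x\<close>. For larger \<open>i\<close>, removing \<open>a\<close> leaves a
    block at the front of \<open>b # \<sigma>\<close> and one factor \<open>1 - x\<close>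
    less.\<close>
  have "(\<Sum>i<length (a # b # \<sigma>). (1 - x) ^ i *
          (of_bool (sorted (take (Suc i) (a # b # \<sigma>))) * tail_weight x (drop (Suc i) (a # b # \<sigma>))))
      = x * x ^ card (descents (b # \<sigma>)) +
        (\<Sum>i<length (b # \<sigma>). of_bool (a \<le> b) * (1 - x) * ((1 - x) ^ i *
          (of_bool (sorted (take (Suc i) (b # \<sigma>))) * tail_weight x (drop (Suc i) (b # \<sigma>)))))"
    unfolding length_Cons[of a] sum.lessThan_Suc_shift
    by (intro arg_cong2[where f = "(+)"] sum.cong refl)
       (auto simp: tail_weight_def intro: order_trans dest: set_take_subset[THEN subsetD])
  \<comment> \<open>At a descent only the first summand survives; otherwise the weights
    \<open>x\<close> and \<open>1 - x\<close> add up to 1.\<close>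
  also have "\<dots> = x ^ card (descents (a # b # \<sigma>))"
    unfolding sum_distrib_left[symmetric] 3(2)[symmetric, OF list.distinct(2)]
    by (auto simp: card_descents_Cons_Cons algebra_simps)
  finally show ?case ..
qed (simp_all add: descents_short tail_weight_def)

section \<open>Generating functions of compositions with a fixed number of parts\<close>

definition list_gf :: "nat \<Rightarrow> (nat list \<Rightarrow> 'a::comm_ring_1) \<Rightarrow> 'a fps" where
  "list_gf k f = Abs_fps (\<lambda>n. \<Sum>\<sigma> | \<sigma> \<in> compositions n \<and> length \<sigma> = k. f \<sigma>)"

lemma finite_compositions_length: "finite {\<sigma> \<in> compositions n. length \<sigma> = k}"
  using finite_compositions by simp

lemma list_gf_cong:
  assumes "\<And>\<sigma>. length \<sigma> = k \<Longrightarrow> f \<sigma> = g \<sigma>"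
  shows "list_gf k f = list_gf k g"
  using assms by (auto simp: list_gf_def fps_eq_iff intro!: sum.cong)

lemma list_gf_cmult: "list_gf k (\<lambda>\<sigma>. c * f \<sigma>) = fps_const c * list_gf k f"
  by (simp add: list_gf_def fps_eq_iff sum_distrib_left)

lemma list_gf_sum: "list_gf k (\<lambda>\<sigma>. \<Sum>i\<in>I. f i \<sigma>) = (\<Sum>i\<in>I. list_gf k (f i))"
  by (auto simp: list_gf_def fps_eq_iff fps_sum_nth intro: sum.swap)

lemma list_gf_0: "list_gf 0 f = fps_const (f [])"
proof (rule fps_ext)
  fix n
  have "{\<sigma> \<in> compositions n. length \<sigma> = 0} = (if n = 0 then {[]} else {})"
    by (auto simp: compositions_def)
  then show "list_gf 0 f $ n = fps_const (f []) $ n"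
    by (simp add: list_gf_def)
qed

lemma list_gf_nth_eq_0: "n < k \<Longrightarrow> list_gf k f $ n = 0"
  using length_le_sum_list
  by (fastforce simp: list_gf_def compositions_def intro!: sum.neutral)

text \<open>With both lengths fixed, cutting after \<open>a\<close> parts inverts concatenation; the
  index of the Cauchy product is the sum of the first piece.\<close>

lemma list_gf_mult:
  "list_gf a f * list_gf b g = list_gf (a + b) (\<lambda>\<sigma>. f (take a \<sigma>) * g (drop a \<sigma>))"
proof (rule fps_ext)
  fix n
  define C where "C k m = {\<sigma> \<in> compositions m. length \<sigma> = k}" for k m
  have fin: "finite (C k m)" for k m
    unfolding C_def by (rule finite_compositions_length)
  have "(list_gf a f * list_gf b g) $ n =
      (\<Sum>i\<in>{0..n}. \<Sum>(\<sigma>, \<rho>)\<in>C a i \<times> C b (n - i). f \<sigma> * g \<rho>)"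
    by (simp add: fps_mult_nth list_gf_def C_def sum_product sum.cartesian_product)
  also have "\<dots> = (\<Sum>(i, \<sigma>, \<rho>)\<in>(SIGMA i:{0..n}. C a i \<times> C b (n - i)). f \<sigma> * g \<rho>)"
    by (subst sum.Sigma) (auto simp: fin)
  also have "\<dots> = (\<Sum>\<sigma>\<in>C (a + b) n. f (take a \<sigma>) * g (drop a \<sigma>))"
  proof (rule sum.reindex_bij_witness[where
        i = "\<lambda>\<sigma>. (sum_list (take a \<sigma>), take a \<sigma>, drop a \<sigma>)" and j = "\<lambda>(i, \<sigma>, \<rho>). \<sigma> @ \<rho>"])
    fix \<sigma> assume "\<sigma> \<in> C (a + b) n"
    moreover have "sum_list \<sigma> = sum_list (take a \<sigma>) + sum_list (drop a \<sigma>)"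
      by (metis append_take_drop_id sum_list_append)
    ultimately show "(sum_list (take a \<sigma>), take a \<sigma>, drop a \<sigma>)
        \<in> (SIGMA i:{0..n}. C a i \<times> C b (n - i))"
      by (auto simp: C_def compositions_def dest: in_set_takeD in_set_dropD)
  qed (auto simp: C_def compositions_def)
  finally show "(list_gf a f * list_gf b g) $ n =
      list_gf (a + b) (\<lambda>\<sigma>. f (take a \<sigma>) * g (drop a \<sigma>)) $ n"
    by (simp add: list_gf_def C_def)
qed

text \<open>The block expansion summed over all compositions: the first block, of length
  \<open>a + 1\<close>, and the remainder vary independently, so \<open>list_gf_mult\<close> factors
  each term.\<close>

lemma list_gf_descents_rec:
  fixes x :: "'a::comm_ring_1"
  shows "list_gf (Suc k) (\<lambda>\<sigma>. x ^ card (descents \<sigma>)) =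
    (\<Sum>a\<le>k. fps_const ((1 - x) ^ a) * list_gf (Suc a) (\<lambda>\<tau>. of_bool (sorted \<tau>)) *
       list_gf (k - a) (tail_weight x))"
proof -
  have "list_gf (Suc k) (\<lambda>\<sigma>. x ^ card (descents \<sigma>)) =
    list_gf (Suc k) (\<lambda>\<sigma>. \<Sum>a\<le>k. (1 - x) ^ a *
       (of_bool (sorted (take (Suc a) \<sigma>)) * tail_weight x (drop (Suc a) \<sigma>)))"
    by (rule list_gf_cong, subst power_card_descents_block) (auto simp: lessThan_Suc_atMost)
  also have "\<dots> = (\<Sum>a\<le>k. fps_const ((1 - x) ^ a) * list_gf (Suc a + (k - a)) (\<lambda>\<sigma>.
       of_bool (sorted (take (Suc a) \<sigma>)) * tail_weight x (drop (Suc a) \<sigma>)))"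
    by (simp add: list_gf_sum list_gf_cmult)
  also have "\<dots> = (\<Sum>a\<le>k. fps_const ((1 - x) ^ a) *
       (list_gf (Suc a) (\<lambda>\<tau>. of_bool (sorted \<tau>)) * list_gf (k - a) (tail_weight x)))"
    by (simp only: list_gf_mult)
  finally show ?thesis
    by (simp only: mult.assoc)
qed

lemma list_gf_tail_weight_Suc:
  "list_gf (Suc k) (tail_weight x) =
     fps_const x * list_gf (Suc k) (\<lambda>\<sigma>. x ^ card (descents \<sigma>))"
  unfolding list_gf_cmult[symmetric] by (rule list_gf_cong) (auto simp: tail_weight_def)

text \<open>Either the first part is 1 and can be deleted, or all parts are at least 2 and each can
  be lowered by 1.\<close>

lemma list_gf_sorted_Suc:
  fixes h :: "nat \<Rightarrow> 'a::comm_ring_1 fps"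
  defines "h \<equiv> \<lambda>a. list_gf a (\<lambda>\<tau>. of_bool (sorted \<tau>))"
  shows "h (Suc a) = fps_X * h a + fps_X ^ Suc a * h (Suc a)"
proof (rule fps_ext)
  fix n
  define S where "S a n = {\<sigma> \<in> compositions n. length \<sigma> = a \<and> sorted \<sigma>}" for a n
  have fin: "finite (S a n)" for a n
    unfolding S_def using finite_compositions by simp
  have h: "h a $ n = of_nat (card (S a n))" for a n
    using finite_compositions_length[of n a]
    by (simp add: h_def list_gf_def S_def sum.If_cases of_bool_def Int_def conj_ac)
  \<comment> \<open>\<open>A\<close> and \<open>B\<close> are the two cases. Their guards keep the
    subtractions from truncating and match the zero coefficients caused by multiplying with a power
    of q.\<close>
  define A where "A = (if n = 0 then {} else (#) 1 ` S a (n - 1))"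
  define B where "B = (if n < Suc a then {} else map Suc ` S (Suc a) (n - Suc a))"
  have sum_map_Suc: "sum_list (map Suc xs) = length xs + sum_list xs" for xs
    by (induction xs) auto
  have "S (Suc a) n \<subseteq> A \<union> B"
  proof
    fix \<sigma> assume "\<sigma> \<in> S (Suc a) n"
    then obtain x \<tau> where \<sigma>: "\<sigma> = x # \<tau>" and pos: "\<forall>y\<in>set \<sigma>. y > 0" and sum: "sum_list \<sigma> = n"
      and len: "length \<tau> = a" and sorted: "sorted \<sigma>"
      by (auto simp: S_def compositions_def length_Suc_conv)
    show "\<sigma> \<in> A \<union> B"
    proof (cases "x = 1")
      case True
      then have "\<tau> \<in> S a (n - 1)" "n \<noteq> 0"
        using \<sigma> pos sum len sorted by (auto simp: S_def compositions_def)
      then show ?thesis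
        using \<sigma> True by (simp add: A_def)
    next
      case False
      define \<rho> where "\<rho> = map (\<lambda>y. y - 1) \<sigma>"
      have ge2: "y \<ge> 2" if "y \<in> set \<sigma>" for y
        using that False \<sigma> pos sorted by fastforce
      have map: "map Suc \<rho> = \<sigma>"
        unfolding \<rho>_def map_map by (rule map_idI) (use ge2 in fastforce)
      moreover have len': "length \<rho> = Suc a"
        by (simp add: \<rho>_def \<sigma> len)
      moreover have "sum_list \<rho> + Suc a = n"
        using sum_map_Suc[of \<rho>] unfolding map sum len' by simp
      moreover have "sorted \<rho>"
        using sorted unfolding map[symmetric] sorted_map by simp
      moreover have "\<forall>y\<in>set \<rho>. y > 0"
        using ge2 by (fastforce simp: \<rho>_def)
      ultimately show ?thesis
        by (auto simp: B_def S_def compositions_def)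
    qed
  qed
  moreover have "A \<union> B \<subseteq> S (Suc a) n"
    by (auto simp: A_def B_def S_def compositions_def sum_map_Suc sorted_map Suc_le_eq less_Suc_eq_le
        split: if_splits)
  moreover have "A \<inter> B = {}"
    by (auto simp: A_def B_def S_def compositions_def)
  moreover have "finite A" "finite B"
    by (auto simp: A_def B_def fin)
  ultimately have "card (S (Suc a) n) = card A + card B"
    by (metis card_Un_disjoint subset_antisym)
  moreover have "card A = (if n = 0 then 0 else card (S a (n - 1)))"
    by (simp add: A_def card_image)
  moreover have "card B = (if n < Suc a then 0 else card (S (Suc a) (n - Suc a)))"
    by (simp add: B_def card_image inj_on_def)
  ultimately show "h (Suc a) $ n = (fps_X * h a + fps_X ^ Suc a * h (Suc a)) $ n"
    unfolding fps_add_nth fps_X_power_mult_nth by (simp add: h)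
qed

section \<open>Block lengths as a composition, and rearrangements of a partition\<close>

text \<open>Indexed like \<open>list_gf_descents_rec\<close>, so that the first part can serve as
  the length of the first block.\<close>

lemma sum_compositions_Suc:
  "(\<Sum>\<alpha>\<in>compositions (Suc k). F \<alpha>) = (\<Sum>a\<le>k. \<Sum>\<alpha>\<in>compositions (k - a). F (Suc a # \<alpha>))"
proof -
  have "(\<Sum>(a, \<alpha>)\<in>(SIGMA a:{..k}. compositions (k - a)). F (Suc a # \<alpha>)) =
      (\<Sum>\<alpha>\<in>compositions (Suc k). F \<alpha>)"
  proof (rule sum.reindex_bij_witness[where
        i = "\<lambda>\<alpha>. (hd \<alpha> - 1, tl \<alpha>)" and j = "\<lambda>(a, \<alpha>). Suc a # \<alpha>"])
    fix \<alpha> assume \<alpha>: "\<alpha> \<in> compositions (Suc k)"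
    then obtain a \<beta> where "\<alpha> = Suc a # \<beta>"
      by (cases \<alpha>) (auto simp: compositions_def gr0_conv_Suc)
    then show "(case (hd \<alpha> - 1, tl \<alpha>) of (a, \<alpha>) \<Rightarrow> Suc a # \<alpha>) = \<alpha>"
      and "(hd \<alpha> - 1, tl \<alpha>) \<in> (SIGMA a:{..k}. compositions (k - a))"
      using \<alpha> by (auto simp: compositions_def)
  qed (auto simp: compositions_def)
  then show ?thesis
    by (simp add: sum.Sigma finite_compositions)
qed

text \<open>Iterating the recursion makes the successive block lengths a composition
  \<open>\<alpha>\<close>. With \<open>tail_weight\<close> the first block too carries a factor
  \<open>x\<close>, so the weight is a plain product, symmetric in the parts.\<close>

lemma list_gf_tail_weight:
  fixes x :: "'a::comm_ring_1"
  shows "list_gf k (tail_weight x) = (\<Sum>\<alpha>\<in>compositions k. prod_list (map (\<lambda>a.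
    fps_const (x * (1 - x) ^ (a - 1)) * list_gf a (\<lambda>\<tau>. of_bool (sorted \<tau>))) \<alpha>))"
proof (induction k rule: less_induct)
  case (less k)
  show ?case
  proof (cases k)
    case 0
    have "compositions 0 = {[]}"
      by (auto simp: compositions_def) (metis list.set_intros(1) neq_Nil_conv less_irrefl)
    then show ?thesis
      by (simp add: 0 list_gf_0 tail_weight_def)
  next
    case (Suc m)
    have "list_gf k (tail_weight x) =
        (\<Sum>a\<le>m. fps_const (x * (1 - x) ^ a) * list_gf (Suc a) (\<lambda>\<tau>. of_bool (sorted \<tau>)) *
           list_gf (m - a) (tail_weight x))"
      unfolding Suc list_gf_tail_weight_Suc list_gf_descents_rec sum_distrib_left
      by (simp add: mult.assoc flip: fps_const_mult)
    also have "\<dots> = (\<Sum>\<alpha>\<in>compositions k. prod_list (map (\<lambda>a.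
        fps_const (x * (1 - x) ^ (a - 1)) * list_gf a (\<lambda>\<tau>. of_bool (sorted \<tau>))) \<alpha>))"
      unfolding Suc sum_compositions_Suc
      by (rule sum.cong) (simp_all add: less Suc sum_distrib_left)
    finally show ?thesis .
  qed
qed

text \<open>Partitions are weakly decreasing while \<open>sort\<close> is increasing, hence the
  \<open>rev\<close>.\<close>

lemma rev_sort_eq_iff:
  fixes lam :: "'a::linorder list"
  assumes "sorted_wrt (\<ge>) lam"
  shows "rev (sort xs) = lam \<longleftrightarrow> mset xs = mset lam"
proof
  have "sorted (rev lam)"
    using assms by (simp add: sorted_wrt_rev)
  moreover assume "mset xs = mset lam"
  ultimately have "sort xs = rev lam"
    by (intro properties_for_sort) auto
  then show "rev (sort xs) = lam"
    by simp
qed auto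

lemma compositions_mset_cong:
  assumes "mset \<alpha> = mset \<beta>"
  shows "\<alpha> \<in> compositions n \<longleftrightarrow> \<beta> \<in> compositions n"
proof -
  have "sum_list \<alpha> = sum_list \<beta>"
    using assms by (metis sum_mset_sum_list)
  with mset_eq_setD[OF assms] show ?thesis
    by (simp add: compositions_def)
qed

text \<open>Compositions are grouped by their decreasing rearrangement; the fibre over
  \<open>lam\<close> consists of all permutations of its parts.\<close>

lemma sum_compositions_partitions:
  fixes F :: "nat list \<Rightarrow> 'a::comm_semiring_1"
  assumes "\<And>\<alpha> \<beta>. mset \<alpha> = mset \<beta> \<Longrightarrow> F \<alpha> = F \<beta>"
  shows "(\<Sum>\<alpha>\<in>compositions k. F \<alpha>) = (\<Sum>lam | is_partition lam \<and> sum_list lam = k.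
    of_nat (card (permutations_of_multiset (mset lam))) * F lam)"
proof -
  let ?P = "{lam. is_partition lam \<and> sum_list lam = k}"
  have "(\<Sum>\<alpha>\<in>compositions k. F \<alpha>) =
      (\<Sum>lam\<in>?P. \<Sum>\<alpha> | \<alpha> \<in> compositions k \<and> rev (sort \<alpha>) = lam. F \<alpha>)"
  proof (rule sum.group[symmetric])
    show "(\<lambda>\<alpha>. rev (sort \<alpha>)) ` compositions k \<subseteq> ?P"
    proof clarify
      fix \<alpha> assume "\<alpha> \<in> compositions k"
      then have "rev (sort \<alpha>) \<in> compositions k"
        using compositions_mset_cong[of "rev (sort \<alpha>)" \<alpha>] by simp
      then show "is_partition (rev (sort \<alpha>)) \<and> sum_list (rev (sort \<alpha>)) = k"
        by (simp add: compositions_def is_partition_def sorted_wrt_rev)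
    qed
  qed (rule finite_compositions finite_partitions)+
  also have "\<dots> = (\<Sum>lam\<in>?P. of_nat (card (permutations_of_multiset (mset lam))) * F lam)"
  proof (rule sum.cong)
    fix lam assume lam: "lam \<in> ?P"
    have "{\<alpha> \<in> compositions k. rev (sort \<alpha>) = lam} = permutations_of_multiset (mset lam)"
    proof (rule set_eqI)
      fix \<alpha>
      have "\<alpha> \<in> compositions k" if "mset \<alpha> = mset lam"
        using compositions_mset_cong[OF that] lam by (simp add: is_partition_def compositions_def)
      then show "\<alpha> \<in> {\<alpha> \<in> compositions k. rev (sort \<alpha>) = lam} \<longleftrightarrow>
          \<alpha> \<in> permutations_of_multiset (mset lam)"
        using lam by (auto simp: rev_sort_eq_iff is_partition_def permutations_of_multiset_def)
    qed
    moreover have "F \<alpha> = F lam" if "\<alpha> \<in> permutations_of_multiset (mset lam)" for \<alpha>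
      using that by (intro assms) (simp add: permutations_of_multiset_def)
    ultimately show "(\<Sum>\<alpha> | \<alpha> \<in> compositions k \<and> rev (sort \<alpha>) = lam. F \<alpha>) =
        of_nat (card (permutations_of_multiset (mset lam))) * F lam"
      by simp
  qed simp
  finally show ?thesis .
qed

section \<open>q-factorials and the factors g\<close>

text \<open>The complete homogeneous symmetric function of degree \<open>a\<close> in q, q^2, q^3,
  ...\<close>

definition h_seq :: "nat \<Rightarrow> Qt fps" where
  "h_seq a = list_gf a (\<lambda>\<tau>. of_bool (sorted \<tau>))"

lemma h_seq_0: "h_seq 0 = 1"
  by (simp add: h_seq_def list_gf_0)

lemma h_seq_Suc: "(1 - qvar ^ Suc a) * h_seq (Suc a) = qvar * h_seq a"
  using list_gf_sorted_Suc[of a, where ?'a = Qt] unfolding h_seq_def[symmetric]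
  by (simp add: algebra_simps)

lemma q_poch_0: "q_poch 0 = 1"
  by (simp add: q_poch_def)

lemma q_poch_Suc: "q_poch (Suc n) = q_poch n * (1 - qvar ^ Suc n)"
  by (simp add: q_poch_def)

lemma h_seq_mult_q_poch: "h_seq a * q_poch a = qvar ^ a"
proof (induction a)
  case (Suc a)
  have "h_seq (Suc a) * q_poch (Suc a) = q_poch a * ((1 - qvar ^ Suc a) * h_seq (Suc a))"
    unfolding q_poch_Suc by (simp only: mult_ac)
  also have "\<dots> = qvar * (h_seq a * q_poch a)"
    unfolding h_seq_Suc by (simp only: mult_ac)
  finally show ?case
    by (simp add: Suc)
qed (simp add: h_seq_0 q_poch_0)

lemma q_poch_nth_0: "q_poch n $ 0 = 1"
  by (induction n) (simp_all add: q_poch_0 q_poch_Suc)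

lemma q_int_nth_0: "n > 0 \<Longrightarrow> q_int n $ 0 = 1"
  by (cases n) (simp_all add: q_int_def sum.lessThan_Suc_shift fps_sum_nth)

lemma prod_fps_nth_0:
  fixes f :: "'b \<Rightarrow> 'a::comm_ring_1 fps"
  shows "prod f A $ 0 = (\<Prod>x\<in>A. f x $ 0)"
  by (induction A rule: infinite_finite_induct) simp_all

lemma q_fact_nth_0: "q_fact n $ 0 = 1"
  by (simp add: q_fact_def prod_fps_nth_0 q_int_nth_0)

lemma q_poch_conv_q_fact: "q_poch n = (1 - qvar) ^ n * q_fact n"
proof -
  have "q_poch n = (\<Prod>i=1..n. (1 - qvar) * q_int i)"
    unfolding q_poch_def q_int_def by (intro prod.cong refl one_diff_power_eq)
  then show ?thesis
    by (simp add: prod.distrib q_fact_def)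
qed

text \<open>A nonzero constant term makes \<open>g\<close> a unit; without it, division of power
  series may discard coefficients.\<close>

lemma fps_divide_mult_cancel:
  fixes f g :: "'a::field fps"
  assumes "g $ 0 \<noteq> 0"
  shows "f / g * g = f"
  using inverse_mult_eq_1[OF assms] by (simp add: fps_divide_unit[OF assms] mult.assoc)

lemma fps_divide_eqI:
  fixes f g :: "'a::field fps"
  assumes "h * g = f" "g $ 0 \<noteq> 0"
  shows "f / g = h"
  using inverse_mult_eq_1'[OF assms(2)]
  by (simp add: fps_divide_unit[OF assms(2)] mult.assoc flip: assms(1))

lemma qvar_power_div_q_poch: "qvar ^ a / q_poch a = h_seq a"
  by (rule fps_divide_eqI) (simp_all add: h_seq_mult_q_poch q_poch_nth_0)

lemma prod_list_map_eq_prod_count_list: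
  fixes f :: "nat \<Rightarrow> 'a::comm_monoid_mult"
  assumes "set xs \<subseteq> A" "finite A"
  shows "prod_list (map f xs) = (\<Prod>x\<in>A. f x ^ count_list xs x)"
proof -
  have "prod_list (map f xs) = prod_mset (image_mset f (mset xs))"
    by (metis mset_map prod_mset_prod_list)
  also have "\<dots> = (\<Prod>x\<in>set xs. f x ^ count_list xs x)"
    by (simp add: image_prod_mset_multiplicity count_mset)
  also have "\<dots> = (\<Prod>x\<in>A. f x ^ count_list xs x)"
    using assms by (intro prod.mono_neutral_left) (auto simp: count_list_0_iff)
  finally show ?thesis .
qed

lemma fact_conv_fps_const: "(fact n :: 'a::field_char_0 fps) = fps_const (fact n)"
  by (metis of_nat_fact fps_of_nat)

text \<open>The number of rearrangements is l! divided by the product of the m_i!, so g is this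
  number times a q-multinomial coefficient.\<close>

lemma g_part_mult:
  assumes "is_partition lam"
  shows "g_part lam * prod_list (map q_fact lam) =
    of_nat (card (permutations_of_multiset (mset lam))) * q_fact (sum_list lam)"
proof -
  let ?n = "sum_list lam"
  define M :: "Qt fps" where "M = (\<Prod>i=1..?n. fact (count_list lam i))"
  have set: "set lam \<subseteq> {1..?n}"
    using assms by (auto simp: is_partition_def Suc_le_eq intro: member_le_sum_list)
  have M0: "M $ 0 \<noteq> 0"
    unfolding M_def prod_fps_nth_0 fact_conv_fps_const by simp
  \<comment> \<open>Absent values contribute 0! = 1, which leaves the product over occurring parts
    that counts permutations of a multiset.\<close>
  have "M = (\<Prod>i\<in>set lam. fact (count_list lam i))"
    unfolding M_def using set by (intro prod.mono_neutral_right) (auto simp: count_list_0_iff)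
  then have "of_nat (card (permutations_of_multiset (mset lam))) * M =
      of_nat (card (permutations_of_multiset (mset lam)) *
        (\<Prod>x\<in>set_mset (mset lam). fact (count (mset lam) x)))"
    by (simp add: count_mset)
  also have "\<dots> = fact (length lam)"
    unfolding card_permutations_of_multiset_aux by simp
  finally have card: "of_nat (card (permutations_of_multiset (mset lam))) * M = fact (length lam)" .
  define P where "P = prod_list (map q_fact lam)"
  have P: "P = (\<Prod>i=1..?n. q_fact i ^ count_list lam i)"
    unfolding P_def using set by (rule prod_list_map_eq_prod_count_list) simp
  have P0: "P $ 0 \<noteq> 0"
    unfolding P by (simp add: prod_fps_nth_0 fps_power_zeroth q_fact_nth_0)
  have "g_part lam = fact (length lam) * q_fact ?n / (M * P)"
    by (simp add: g_part_def M_def P prod.distrib)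
  then have "g_part lam * (M * P) = fact (length lam) * q_fact ?n"
    using M0 P0 by (simp add: fps_divide_mult_cancel)
  also have "\<dots> = of_nat (card (permutations_of_multiset (mset lam))) * q_fact ?n * M"
    by (simp add: mult_ac flip: card)
  finally have "(g_part lam * P) * M =
      of_nat (card (permutations_of_multiset (mset lam))) * q_fact ?n * M"
    by (simp only: mult_ac)
  moreover have "M \<noteq> 0"
    using M0 by auto
  ultimately show ?thesis
    by (simp add: P_def)
qed

text \<open>Since h_a = q^a / (q)_a, both sides have numerator q^n. The quotient of the denominators
  is the q-multinomial coefficient in g, because the powers of 1 - q cancel when the parts sum to
  n.\<close>

lemma h_seq_mult_g_part:
  assumes "is_partition lam"
  shows "h_seq (sum_list lam) * g_part lam =
    of_nat (card (permutations_of_multiset (mset lam))) * prod_list (map h_seq lam)"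
proof -
  let ?n = "sum_list lam" and ?c = "of_nat (card (permutations_of_multiset (mset lam))) :: Qt fps"
  define P where "P = prod_list (map q_poch lam)"
  have P: "P = (1 - qvar) ^ ?n * prod_list (map q_fact lam)"
    unfolding P_def by (induction lam) (simp_all add: q_poch_conv_q_fact power_add mult_ac)
  have P_h: "prod_list (map h_seq lam) * P = qvar ^ ?n"
    unfolding P_def by (induction lam) (simp_all add: power_add mult_ac flip: h_seq_mult_q_poch)
  have "P $ 0 = 1"
    unfolding P_def by (induction lam) (simp_all add: q_poch_nth_0)
  then have "P \<noteq> 0"
    by auto
  \<comment> \<open>Both sides are multiplied by \<open>P\<close>, the product of the (q)_a over the
    parts, to clear denominators; it has constant term 1 and can be cancelled.\<close>
  have "h_seq ?n * g_part lam * P =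
      h_seq ?n * (1 - qvar) ^ ?n * (g_part lam * prod_list (map q_fact lam))"
    by (simp add: P mult_ac)
  also have "\<dots> = ?c * (h_seq ?n * q_poch ?n)"
    unfolding g_part_mult[OF assms] q_poch_conv_q_fact by (simp only: mult_ac)
  also have "\<dots> = ?c * prod_list (map h_seq lam) * P"
    by (simp add: h_seq_mult_q_poch mult.assoc flip: P_h)
  finally show ?thesis
    using \<open>P \<noteq> 0\<close> by simp
qed

section \<open>From descent counts to series over Q(t)\<close>

lemma to_fract_power: "to_fract (p ^ n) = to_fract p ^ n"
  by (induction n) simp_all

text \<open>Grouping the elements by the value of \<open>s\<close> turns the counts that define
  \<open>DC_parts\<close> and \<open>DC\<close> into a sum of powers of t.\<close>

lemma sum_monom_card:
  fixes s :: "'b \<Rightarrow> nat"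
  assumes "finite S" "\<And>x. x \<in> S \<Longrightarrow> s x \<le> n"
  shows "to_fract (\<Sum>r\<le>n. monom (int (card {x \<in> S. s x = r})) r) =
    (\<Sum>x\<in>S. to_fract [:0, 1:] ^ s x)"
proof -
  have "(\<Sum>r\<le>n. monom (int (card {x \<in> S. s x = r})) r) =
      (\<Sum>r\<le>n. \<Sum>x | x \<in> S \<and> s x = r. [:0, 1:] ^ s x)"
  proof (rule sum.cong)
    fix r
    have "(\<Sum>x | x \<in> S \<and> s x = r. [:0, 1 :: int:] ^ s x) =
        (\<Sum>x | x \<in> S \<and> s x = r. [:0, 1:] ^ r)"
      by (rule sum.cong) auto
    also have "\<dots> = monom (int (card {x \<in> S. s x = r})) r"
      by (simp add: monom_altdef of_nat_poly)
    finally show "monom (int (card {x \<in> S. s x = r})) r =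
        (\<Sum>x | x \<in> S \<and> s x = r. [:0, 1:] ^ s x)" ..
  qed simp
  also have "\<dots> = (\<Sum>x\<in>S. [:0, 1:] ^ s x)"
    using assms by (intro sum.group) auto
  finally show ?thesis
    by (simp add: to_fract_power)
qed

lemma embed_DC_parts:
  "embed_Qt (DC_parts k) = list_gf k (\<lambda>\<sigma>. to_fract [:0, 1:] ^ card (descents \<sigma>))"
proof (rule fps_ext)
  fix n
  have "dc_parts r n k =
      card {\<sigma> \<in> {\<sigma> \<in> compositions n. length \<sigma> = k}. card (descents \<sigma>) = r}" for r
    by (simp add: dc_parts_def conj_assoc)
  then show "embed_Qt (DC_parts k) $ n =
      list_gf k (\<lambda>\<sigma>. to_fract [:0, 1:] ^ card (descents \<sigma>)) $ n"
    using sum_monom_card[OF finite_compositions_length[of n k], of "\<lambda>\<sigma>. card (descents \<sigma>)" n]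
    by (simp add: embed_Qt_def DC_parts_def list_gf_def card_descents_le del: to_fract_sum)
qed

section \<open>Sums of families of power series\<close>

text \<open>If every \<open>F k\<close> has order at least \<open>k\<close>, this is \<open>\<Sum>\<^sub>k F k\<close>; otherwise coefficients are dropped.\<close>

definition fps_total :: "(nat \<Rightarrow> 'a::comm_ring_1 fps) \<Rightarrow> 'a fps" where
  "fps_total F = Abs_fps (\<lambda>n. \<Sum>k\<le>n. F k $ n)"

lemma fps_total_add: "fps_total (\<lambda>k. F k + G k) = fps_total F + fps_total G"
  by (simp add: fps_total_def fps_eq_iff sum.distrib)

lemma fps_total_cmult: "fps_total (\<lambda>k. fps_const c * F k) = fps_const c * fps_total F"
  by (simp add: fps_total_def fps_eq_iff sum_distrib_left)

lemma fps_total_single: "fps_total (\<lambda>k. if k = 0 then c else 0) = c"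
  by (simp add: fps_total_def fps_eq_iff if_distrib[of "\<lambda>f. f $ _"] sum.delta cong: if_cong)

text \<open>Terms of high order do not reach coefficient \<open>n\<close>, so all truncated sums can
  be extended to the same bound \<open>n\<close> and the product regrouped by
  \<open>k = i + j\<close>.\<close>

lemma fps_total_mult:
  fixes F G :: "nat \<Rightarrow> 'a::comm_ring_1 fps"
  assumes F: "\<And>k n. n < k \<Longrightarrow> F k $ n = 0" and G: "\<And>k n. n < k \<Longrightarrow> G k $ n = 0"
  shows "fps_total F * fps_total G = fps_total (\<lambda>k. \<Sum>i\<le>k. F i * G (k - i))"
proof (rule fps_ext)
  fix n
  have extend: "(\<Sum>k\<le>m. H k $ m) = (\<Sum>k\<le>n. H k $ m)"
    if "m \<le> n" "\<And>k n. n < k \<Longrightarrow> H k $ n = 0" for m and H :: "nat \<Rightarrow> 'a fps"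
    using that by (intro sum.mono_neutral_left) auto
  have "(fps_total F * fps_total G) $ n =
      (\<Sum>m=0..n. (\<Sum>i\<le>n. F i $ m) * (\<Sum>j\<le>n. G j $ (n - m)))"
    unfolding fps_mult_nth by (intro sum.cong) (auto simp: fps_total_def extend F G)
  also have "\<dots> = (\<Sum>i\<le>n. \<Sum>j\<le>n. (F i * G j) $ n)"
    unfolding fps_mult_nth sum_product
    by (rule trans[OF sum.swap], rule sum.cong[OF refl], rule sum.swap)
  also have "\<dots> = (\<Sum>(i, j)\<in>{..n} \<times> {..n}. (F i * G j) $ n)"
    by (rule sum.cartesian_product)
  \<comment> \<open>Outside the triangle the order of \<open>F i * G j\<close> exceeds
    \<open>n\<close>.\<close>
  also have "\<dots> = (\<Sum>(i, j)\<in>{(i, j). i + j \<le> n}. (F i * G j) $ n)"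
  proof (rule sum.mono_neutral_right)
    have "(F i * G j) $ n = 0" if "\<not> i + j \<le> n" for i j
    proof -
      have "F i $ m * G j $ (n - m) = 0" if "m \<le> n" for m
        using that \<open>\<not> i + j \<le> n\<close> F[of m i] G[of "n - m" j] by (cases "m < i") auto
      then show ?thesis
        by (simp add: fps_mult_nth)
    qed
    then show "\<forall>p\<in>{..n} \<times> {..n} - {(i, j). i + j \<le> n}. (case p of (i, j) \<Rightarrow> (F i * G j) $ n) = 0"
      unfolding case_prod_unfold by (intro ballI) simp
  qed auto
  also have "\<dots> = (\<Sum>k\<le>n. \<Sum>i\<le>k. (F i * G (k - i)) $ n)"
    by (rule sum.triangle_reindex_eq)
  finally show "(fps_total F * fps_total G) $ n =
      fps_total (\<lambda>k. \<Sum>i\<le>k. F i * G (k - i)) $ n"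
    by (simp add: fps_total_def fps_sum_nth)
qed

text \<open>Convergence of power series is coefficientwise, and coefficient \<open>n\<close> of a
  finite partial sum is final once all \<open>x\<close> with \<open>s x \<le> n\<close> are
  included.\<close>

lemma fps_has_sumI:
  fixes f :: "'b \<Rightarrow> 'a::comm_ring_1 fps" and s :: "'b \<Rightarrow> nat"
  assumes fin: "\<And>n. finite {x \<in> A. s x \<le> n}"
    and zero: "\<And>x n. x \<in> A \<Longrightarrow> n < s x \<Longrightarrow> f x $ n = 0"
    and sum: "\<And>n. S $ n = (\<Sum>x | x \<in> A \<and> s x \<le> n. f x $ n)"
  shows "(f has_sum S) A"
  unfolding has_sum_def
proof (rule tendsto_fpsI)
  fix n
  have "sum f Y $ n = S $ n" if "finite Y" "{x \<in> A. s x \<le> n} \<subseteq> Y" "Y \<subseteq> A" for Y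
    unfolding fps_sum_nth sum using that
    by (intro sum.mono_neutral_right) (auto intro!: zero simp: not_le)
  then show "eventually (\<lambda>Y. sum f Y $ n = S $ n) (finite_subsets_at_top A)"
    unfolding eventually_finite_subsets_at_top
    by (intro exI[of _ "{x \<in> A. s x \<le> n}"]) (use fin in auto)
qed

lemma fps_mult_nth_eq_0:
  fixes f g :: "'a::comm_ring_1 fps"
  assumes "\<And>i. i \<le> n \<Longrightarrow> f $ i = 0"
  shows "(f * g) $ n = 0"
  using assms by (simp add: fps_mult_nth)

lemma h_seq_nth_eq_0: "n < k \<Longrightarrow> h_seq k $ n = 0"
  by (simp add: h_seq_def list_gf_nth_eq_0)

text \<open>A composition of \<open>n\<close> has at most \<open>n\<close> parts, so the truncation
  in \<open>fps_total\<close> loses nothing.\<close>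

lemma embed_DC: "embed_Qt DC = fps_total (\<lambda>k. embed_Qt (DC_parts k))"
proof (rule fps_ext)
  fix n
  have "embed_Qt DC $ n = (\<Sum>\<sigma>\<in>compositions n. to_fract [:0, 1:] ^ card (descents \<sigma>))"
    using sum_monom_card[OF finite_compositions[of n], of "\<lambda>\<sigma>. card (descents \<sigma>)" n]
    by (simp add: embed_Qt_def DC_def dc_def card_descents_le del: to_fract_sum)
  also have "\<dots> = (\<Sum>k\<le>n. \<Sum>\<sigma> | \<sigma> \<in> compositions n \<and> length \<sigma> = k.
      to_fract [:0, 1:] ^ card (descents \<sigma>))"
  proof (rule sum.group[symmetric])
    show "length ` compositions n \<subseteq> {..n}"
      by (auto simp: compositions_def intro: length_le_sum_list)
  qed (simp_all add: finite_compositions)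
  finally show "embed_Qt DC $ n = fps_total (\<lambda>k. embed_Qt (DC_parts k)) $ n"
    by (simp add: embed_DC_parts fps_total_def list_gf_def)
qed

section \<open>The sum over the partitions of a fixed k\<close>

text \<open>The exponents \<open>a - 1\<close> add up to the sum minus the length; positive parts
  keep these subtractions from truncating.\<close>

lemma prod_list_block_weights:
  assumes "\<forall>a\<in>set lam. a > 0"
  shows "prod_list (map (\<lambda>a. fps_const (c * d ^ (a - 1)) * f a) lam) =
    fps_const (c :: 'a::comm_ring_1) ^ length lam * fps_const d ^ (sum_list lam - length lam) *
      prod_list (map f lam)"
  using assms
proof (induction lam)
  case (Cons a lam)
  then have len: "sum_list (a # lam) - length (a # lam) = (a - 1) + (sum_list lam - length lam)"
    using length_le_sum_list[of lam] by simp
  show ?case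
    unfolding len power_add
    using Cons by (simp add: mult_ac flip: fps_const_mult fps_const_power)
qed simp

lemma prod_list_map_mset_cong:
  fixes f :: "'b \<Rightarrow> 'a::comm_monoid_mult"
  assumes "mset xs = mset ys"
  shows "prod_list (map f xs) = prod_list (map f ys)"
  using assms by (metis mset_map prod_mset_prod_list)

lemma one_minus_tvar: "1 - tvar = fps_const (1 - to_fract [:0, 1:])"
  by (simp add: tvar_def flip: fps_const_sub fps_const_1_eq_1)

lemma embed_DC_parts_partitions:
  assumes "k \<ge> 1"
  shows "embed_Qt (DC_parts k) = (\<Sum>lam | is_partition lam \<and> sum_list lam = k.
    h_seq k * (tvar ^ (length lam - 1) * (1 - tvar) ^ (k - length lam) * g_part lam))"
proof -
  let ?P = "{lam. is_partition lam \<and> sum_list lam = k}"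
  let ?c = "\<lambda>lam. of_nat (card (permutations_of_multiset (mset lam))) :: Qt fps"
  \<comment> \<open>The identity is proved times t: for k >= 1 this turns the descent weight into
    \<open>tail_weight\<close>, whose expansion is symmetric. The factor t is cancelled at the
    end.\<close>
  have "tvar * embed_Qt (DC_parts k) = list_gf k (tail_weight (to_fract [:0, 1:]))"
    using assms by (cases k) (simp_all add: embed_DC_parts list_gf_tail_weight_Suc tvar_def)
  also have "\<dots> = (\<Sum>lam\<in>?P. ?c lam * prod_list (map (\<lambda>a.
      fps_const (to_fract [:0, 1:] * (1 - to_fract [:0, 1:]) ^ (a - 1)) * h_seq a) lam))"
    unfolding list_gf_tail_weight h_seq_def[symmetric]
    by (rule sum_compositions_partitions) (rule prod_list_map_mset_cong)
  also have "\<dots> = (\<Sum>lam\<in>?P. tvar *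
      (h_seq k * (tvar ^ (length lam - 1) * (1 - tvar) ^ (k - length lam) * g_part lam)))"
  proof (rule sum.cong)
    fix lam assume "lam \<in> ?P"
    then have lam: "is_partition lam" "sum_list lam = k" "\<forall>a\<in>set lam. a > 0"
      by (auto simp: is_partition_def)
    have "lam \<noteq> []"
      using lam assms by auto
    then have t: "tvar ^ length lam = tvar * tvar ^ (length lam - 1)"
      by (cases lam) auto
    have "?c lam * prod_list (map (\<lambda>a.
        fps_const (to_fract [:0, 1:] * (1 - to_fract [:0, 1:]) ^ (a - 1)) * h_seq a) lam) =
        ?c lam * (tvar ^ length lam * (1 - tvar) ^ (k - length lam) * prod_list (map h_seq lam))"
      unfolding prod_list_block_weights[OF lam(3)] lam(2) one_minus_tvar[symmetric] tvar_def[symmetric] ..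
    also have "\<dots> = tvar ^ length lam * (1 - tvar) ^ (k - length lam) * (h_seq k * g_part lam)"
      using h_seq_mult_g_part[OF lam(1)] unfolding lam(2) by (simp only: mult_ac)
    finally show "?c lam * prod_list (map (\<lambda>a.
        fps_const (to_fract [:0, 1:] * (1 - to_fract [:0, 1:]) ^ (a - 1)) * h_seq a) lam) =
        tvar * (h_seq k * (tvar ^ (length lam - 1) * (1 - tvar) ^ (k - length lam) * g_part lam))"
      unfolding t by (simp only: mult_ac)
  qed simp
  finally have "tvar * embed_Qt (DC_parts k) = tvar * (\<Sum>lam\<in>?P.
      h_seq k * (tvar ^ (length lam - 1) * (1 - tvar) ^ (k - length lam) * g_part lam))"
    by (simp only: sum_distrib_left)
  moreover have "tvar \<noteq> 0"
    by (simp add: tvar_def)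
  ultimately show ?thesis
    by simp
qed

section \<open>Euler's series as an inverse\<close>

text \<open>The elementary symmetric function of degree \<open>j\<close> in q, q^2, q^3, ..., with
  sign (-1)^j.\<close>

definition e_seq :: "nat \<Rightarrow> Qt fps" where
  "e_seq j = qvar ^ ((j + 1) choose 2) * ((- 1) ^ j / q_poch j)"

lemma e_seq_0: "e_seq 0 = 1"
  by (simp add: e_seq_def q_poch_0 numeral_2_eq_2)

lemma e_seq_mult_q_poch: "e_seq j * q_poch j = qvar ^ ((j + 1) choose 2) * (- 1) ^ j"
  by (simp add: e_seq_def mult.assoc fps_divide_mult_cancel q_poch_nth_0)

lemma e_seq_Suc: "(1 - qvar ^ Suc j) * e_seq (Suc j) = - (qvar ^ Suc j * e_seq j)"
proof -
  have choose: "(Suc j + 1) choose 2 = Suc j + ((j + 1) choose 2)"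
    by (simp add: numeral_2_eq_2)
  have "(1 - qvar ^ Suc j) * e_seq (Suc j) * q_poch j = e_seq (Suc j) * q_poch (Suc j)"
    unfolding q_poch_Suc by (simp only: mult_ac)
  also have "\<dots> = - (qvar ^ Suc j * (e_seq j * q_poch j))"
    unfolding e_seq_mult_q_poch choose power_add by simp
  finally have "(1 - qvar ^ Suc j) * e_seq (Suc j) * q_poch j = - (qvar ^ Suc j * e_seq j) * q_poch j"
    by (simp only: mult_ac mult_minus_left mult_minus_right)
  moreover have "q_poch j \<noteq> 0"
    using q_poch_nth_0[of j] by auto
  ultimately show ?thesis
    using mult_right_cancel by blast
qed

text \<open>Coefficientwise form of H(z) E(-z) = 1 for the complete and elementary symmetric
  functions.\<close>

lemma h_seq_e_seq_convolution:
  "(\<Sum>i\<le>n. h_seq i * e_seq (n - i)) = (if n = 0 then 1 else 0)"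
proof (cases n)
  case 0
  then show ?thesis
    by (simp add: h_seq_0 e_seq_0)
next
  case (Suc m)
  \<comment> \<open>The splitting \<open>1 - q\<^sup>n = q\<^bsup>n - i\<^esup> (1 - q\<^sup>i) + (1 - q\<^bsup>n - i\<^esup>)\<close> makes the sum cancel termwise after a shift.\<close>
  have "(1 - qvar ^ n) * (\<Sum>i\<le>n. h_seq i * e_seq (n - i)) =
      (\<Sum>i\<le>n. qvar ^ (n - i) * e_seq (n - i) * ((1 - qvar ^ i) * h_seq i)) +
      (\<Sum>i\<le>n. h_seq i * ((1 - qvar ^ (n - i)) * e_seq (n - i)))"
    unfolding sum_distrib_left sum.distrib[symmetric]
  proof (rule sum.cong)
    fix i assume "i \<in> {..n}"
    then have "qvar ^ n = qvar ^ i * qvar ^ (n - i)"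
      by (simp flip: power_add)
    then show "(1 - qvar ^ n) * (h_seq i * e_seq (n - i)) =
        qvar ^ (n - i) * e_seq (n - i) * ((1 - qvar ^ i) * h_seq i) +
        h_seq i * ((1 - qvar ^ (n - i)) * e_seq (n - i))"
      by (simp add: algebra_simps)
  qed simp
  \<comment> \<open>Here the summand \<open>i = 0\<close> vanishes, in the other sum the summand
    \<open>i = n\<close>, both because 1 - q^0 = 0; the recursions of \<open>h_seq\<close> and
    \<open>e_seq\<close> apply to the rest.\<close>
  also have "(\<Sum>i\<le>n. qvar ^ (n - i) * e_seq (n - i) * ((1 - qvar ^ i) * h_seq i)) =
      (\<Sum>i\<le>m. qvar ^ (m - i) * e_seq (m - i) * (qvar * h_seq i))"
    unfolding Suc sum.atMost_Suc_shift h_seq_Suc by simp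
  also have "(\<Sum>i\<le>n. h_seq i * ((1 - qvar ^ (n - i)) * e_seq (n - i))) =
      (\<Sum>i\<le>m. - (qvar ^ (m - i) * e_seq (m - i) * (qvar * h_seq i)))"
  proof -
    have "h_seq i * ((1 - qvar ^ (Suc m - i)) * e_seq (Suc m - i)) =
        - (qvar ^ (m - i) * e_seq (m - i) * (qvar * h_seq i))" if "i \<le> m" for i
      unfolding Suc_diff_le[OF that] e_seq_Suc by (simp add: mult_ac)
    then show ?thesis
      unfolding Suc sum.atMost_Suc by simp
  qed
  finally have "(1 - qvar ^ n) * (\<Sum>i\<le>n. h_seq i * e_seq (n - i)) = 0"
    by (simp add: sum_negf)
  moreover have "(1 - qvar ^ n) $ 0 = 1"
    by (simp add: Suc)
  then have "1 - qvar ^ n \<noteq> 0"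
    by force
  ultimately show ?thesis
    by (simp add: Suc)
qed

abbreviation euler_term :: "nat \<Rightarrow> Qt fps" where
  "euler_term j \<equiv> qvar ^ ((j + 1) choose 2) * ((tvar - 1) ^ j / q_poch j)"

lemma euler_term_conv_e_seq: "euler_term j = (1 - tvar) ^ j * e_seq j"
proof -
  have "(tvar - 1) ^ j = (- 1) ^ j * (1 - tvar) ^ j"
    by (metis minus_diff_eq power_minus)
  then show ?thesis
    by (simp add: e_seq_def fps_divide_unit q_poch_nth_0 mult_ac)
qed

lemma euler_term_nth_eq_0:
  assumes "n < j"
  shows "euler_term j $ n = 0"
proof -
  have "j \<le> (j + 1) choose 2"
    by (simp add: numeral_2_eq_2)
  then show ?thesis
    using assms unfolding fps_X_power_mult_nth by simp
qed

text \<open>In the convolution the powers of 1 - t combine to (1 - t)^k, independent of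
  \<open>i\<close>, so the relation between \<open>h_seq\<close> and \<open>e_seq\<close> survives
  the scaling.\<close>

lemma euler_inverse:
  "fps_total (\<lambda>k. (1 - tvar) ^ k * h_seq k) * fps_total euler_term = 1"
proof -
  have "fps_total (\<lambda>k. (1 - tvar) ^ k * h_seq k) * fps_total euler_term =
      fps_total (\<lambda>k. \<Sum>i\<le>k. (1 - tvar) ^ i * h_seq i * euler_term (k - i))"
    using euler_term_nth_eq_0
    by (intro fps_total_mult)
       (auto simp: mult.commute[of _ "h_seq _"] intro!: fps_mult_nth_eq_0 h_seq_nth_eq_0)
  also have "(\<lambda>k. \<Sum>i\<le>k. (1 - tvar) ^ i * h_seq i * euler_term (k - i)) =
      (\<lambda>k. if k = 0 then 1 else 0)"
  proof
    fix k
    have "(\<Sum>i\<le>k. (1 - tvar) ^ i * h_seq i * euler_term (k - i)) =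
        (\<Sum>i\<le>k. (1 - tvar) ^ k * (h_seq i * e_seq (k - i)))"
    proof (rule sum.cong)
      fix i assume "i \<in> {..k}"
      then have "(1 - tvar) ^ k = (1 - tvar) ^ i * (1 - tvar) ^ (k - i)"
        by (simp flip: power_add)
      then show "(1 - tvar) ^ i * h_seq i * euler_term (k - i) =
          (1 - tvar) ^ k * (h_seq i * e_seq (k - i))"
        unfolding euler_term_conv_e_seq by (simp only: mult_ac)
    qed simp
    then show "(\<Sum>i\<le>k. (1 - tvar) ^ i * h_seq i * euler_term (k - i)) = (if k = 0 then 1 else 0)"
      by (simp add: h_seq_e_seq_convolution flip: sum_distrib_left)
  qed
  finally show ?thesis
    by (simp add: fps_total_single)
qed

section \<open>The quotient formula\<close>

text \<open>For the totals, D = 1 + A B and B = t D + (1 - t) give D (1 - t A) = H with H = 1 + (1 -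
  t) A. From H E = 1 follows H (E - t) = (1 - t) (1 - t A); multiplying by D and cancelling H gives
  the claim.\<close>

lemma embed_DC_mult_euler: "embed_Qt DC * (fps_total euler_term - tvar) = 1 - tvar"
proof -
  define T :: Qt where "T = to_fract [:0, 1:]"
  define D where "D = (\<lambda>k. embed_Qt (DC_parts k))"
  \<comment> \<open>\<open>A\<close> describes a first block, which is nonempty and so contributes 0
    at \<open>k = 0\<close>; \<open>B\<close> describes the remainder after it.\<close>
  define A where "A k = (if k = 0 then 0 else fps_const ((1 - T) ^ (k - 1)) * h_seq k)" for k
  define B where "B k = list_gf k (tail_weight T)" for k
  have tvar: "tvar = fps_const T"
    by (simp add: tvar_def T_def)
  have t1: "1 - tvar = fps_const (1 - T)"
    by (simp add: one_minus_tvar T_def)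
  have D: "D k = list_gf k (\<lambda>\<sigma>. T ^ card (descents \<sigma>))" for k
    by (simp add: D_def embed_DC_parts T_def)
  have "D k = (if k = 0 then 1 else 0) + (\<Sum>i\<le>k. A i * B (k - i))" for k
  proof (cases k)
    case (Suc m)
    show ?thesis
      unfolding Suc D list_gf_descents_rec sum.atMost_Suc_shift
      by (simp add: A_def B_def h_seq_def)
  qed (simp add: D A_def list_gf_0 descents_short)
  then have "fps_total D =
      fps_total (\<lambda>k. (if k = 0 then 1 else 0) + (\<Sum>i\<le>k. A i * B (k - i)))"
    by (intro arg_cong[where f = fps_total] ext)
  moreover have "fps_total A * fps_total B = fps_total (\<lambda>k. \<Sum>i\<le>k. A i * B (k - i))"
    by (rule fps_total_mult) (auto simp: A_def B_def h_seq_nth_eq_0 list_gf_nth_eq_0)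
  ultimately have "fps_total D = 1 + fps_total A * fps_total B"
    by (simp only: fps_total_add fps_total_single)
  \<comment> \<open>The correction at \<open>k = 0\<close> is due to the empty list, whose tail
    weight is 1 instead of t.\<close>
  moreover have "B k = fps_const T * D k + (if k = 0 then 1 - tvar else 0)" for k
    by (cases k)
       (simp_all add: B_def D list_gf_tail_weight_Suc list_gf_0 tail_weight_def descents_short tvar)
  then have "fps_total B =
      fps_total (\<lambda>k. fps_const T * D k + (if k = 0 then 1 - tvar else 0))"
    by (intro arg_cong[where f = fps_total] ext)
  then have "fps_total B = tvar * fps_total D + (1 - tvar)"
    by (simp only: fps_total_add fps_total_cmult fps_total_single tvar)
  ultimately have D_eq: "fps_total D = 1 + fps_total A * (tvar * fps_total D + (1 - tvar))"
    by simp
  define H where "H = fps_total (\<lambda>k. (1 - tvar) ^ k * h_seq k)"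
  define E where "E = fps_total euler_term"
  have "(1 - tvar) ^ k * h_seq k = (if k = 0 then 1 else 0) + fps_const (1 - T) * A k" for k
    by (cases k) (simp_all add: t1 A_def h_seq_0 flip: mult.assoc)
  then have "H = fps_total (\<lambda>k. (if k = 0 then 1 else 0) + fps_const (1 - T) * A k)"
    unfolding H_def by (intro arg_cong[where f = fps_total] ext)
  then have H: "H = 1 + (1 - tvar) * fps_total A"
    by (simp only: fps_total_add fps_total_cmult fps_total_single t1)
  have HE: "H * E = 1"
    unfolding H_def E_def by (rule euler_inverse)
  have "H * (fps_total D * (E - tvar)) = fps_total D * (H * E - tvar * H)"
    by (simp add: algebra_simps)
  also have "\<dots> = (1 - tvar) * (fps_total D - fps_total A * (tvar * fps_total D))"
    unfolding HE unfolding H by (simp add: algebra_simps)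
  also have "fps_total D - fps_total A * (tvar * fps_total D) = H"
    using D_eq unfolding H by (simp add: algebra_simps)
  finally have "H * (fps_total D * (E - tvar)) = H * (1 - tvar)"
    by (simp only: mult.commute)
  moreover have "H \<noteq> 0"
    using HE by auto
  ultimately show ?thesis
    by (simp add: embed_DC D_def E_def)
qed

section \<open>The case k = 0, infinite sums and the final statement\<close>

lemma DC_parts_0: "DC_parts 0 = 1"
proof -
  have "embed_Qt (DC_parts 0) = 1"
    by (simp add: embed_DC_parts list_gf_0 descents_short)
  \<comment> \<open>Injectivity of \<open>to_fract\<close> brings the identity back to
    Z[t][[q]].\<close>
  then have "to_fract (DC_parts 0 $ n) = to_fract (1 $ n)" for n
    by (simp add: embed_Qt_def fps_eq_iff)
  then show ?thesis
    by (simp add: fps_eq_iff)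
qed

text \<open>The factor h_n gives the term of a partition of n order at least n, so the sum
  converges; grouping by size recovers the series \<open>DC_parts k\<close> with k >= 1.\<close>

lemma has_sum_partitions:
  "((\<lambda>mu. qvar ^ sum_list mu / q_poch (sum_list mu) *
      tvar ^ (length mu - 1) * (1 - tvar) ^ (sum_list mu - length mu) * g_part mu)
    has_sum (embed_Qt DC - 1)) {mu. is_partition mu \<and> mu \<noteq> []}"
  unfolding qvar_power_div_q_poch mult.assoc
proof (rule fps_has_sumI[where s = sum_list])
  let ?A = "{mu. is_partition mu \<and> mu \<noteq> []}"
  let ?f = "\<lambda>mu. h_seq (sum_list mu) * (tvar ^ (length mu - 1) *
      ((1 - tvar) ^ (sum_list mu - length mu) * g_part mu))"
  show fin: "finite {mu \<in> ?A. sum_list mu \<le> n}" for n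
    by (rule finite_subset[of _ "\<Union>k\<le>n. {mu. is_partition mu \<and> sum_list mu = k}"])
       (auto simp: finite_partitions)
  show "?f mu $ n = 0" if "n < sum_list mu" for mu n
    using that by (intro fps_mult_nth_eq_0 h_seq_nth_eq_0) auto
  show "(embed_Qt DC - 1) $ n = (\<Sum>mu | mu \<in> ?A \<and> sum_list mu \<le> n. ?f mu $ n)" for n
  proof -
    have pos: "sum_list mu > 0" if "is_partition mu" "mu \<noteq> []" for mu
      using that by (cases mu) (auto simp: is_partition_def)
    have "(\<Sum>mu | mu \<in> ?A \<and> sum_list mu \<le> n. ?f mu $ n) =
        (\<Sum>k=1..n. \<Sum>mu | mu \<in> {mu \<in> ?A. sum_list mu \<le> n} \<and> sum_list mu = k. ?f mu $ n)"
      by (rule sum.group[symmetric]) (use fin in \<open>auto simp: Suc_le_eq pos\<close>)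
    also have "\<dots> = (\<Sum>k=1..n. embed_Qt (DC_parts k) $ n)"
    proof (rule sum.cong)
      fix k assume k: "k \<in> {1..n}"
      then have "{mu \<in> {mu \<in> ?A. sum_list mu \<le> n}. sum_list mu = k} =
          {mu. is_partition mu \<and> sum_list mu = k}"
        by auto
      then show "(\<Sum>mu | mu \<in> {mu \<in> ?A. sum_list mu \<le> n} \<and> sum_list mu = k. ?f mu $ n) =
          embed_Qt (DC_parts k) $ n"
        using k by (simp add: embed_DC_parts_partitions fps_sum_nth mult.assoc)
    qed simp
    \<comment> \<open>The missing index \<open>k = 0\<close> accounts for the 1 subtracted from
      \<open>embed_Qt DC\<close>.\<close>
    also have "\<dots> = (\<Sum>k\<le>n. embed_Qt (DC_parts k) $ n) - embed_Qt (DC_parts 0) $ n"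
      by (simp add: atMost_atLeast0 sum.atLeast_Suc_atMost)
    finally show ?thesis
      by (simp add: embed_DC fps_total_def embed_DC_parts[of 0] list_gf_0 descents_short)
  qed
qed

lemma euler_term_sums: "euler_term sums fps_total euler_term"
proof (intro has_sum_imp_sums fps_has_sumI[where s = "\<lambda>j. j"])
  show "euler_term j $ n = 0" if "n < j" for j n
    using that by (rule euler_term_nth_eq_0)
  show "fps_total euler_term $ n = (\<Sum>j | j \<in> UNIV \<and> j \<le> n. euler_term j $ n)" for n
    by (simp add: fps_total_def atMost_def)
qed simp

theorem corollary12:
  shows
    "DC_parts 0 = 1 \<and>
     (\<forall>k\<ge>1. embed_Qt (DC_parts k) =
        qvar ^ k / q_poch k *
        (\<Sum>lam | is_partition lam \<and> sum_list lam = k.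
           tvar ^ (length lam - 1) * (1 - tvar) ^ (k - length lam) * g_part lam)) \<and>
     (\<lambda>mu. qvar ^ sum_list mu / q_poch (sum_list mu) *
        tvar ^ (length mu - 1) * (1 - tvar) ^ (sum_list mu - length mu) * g_part mu)
       summable_on {mu. is_partition mu \<and> mu \<noteq> []} \<and>
     embed_Qt DC =
       1 + (\<Sum>\<^sub>\<infinity>mu\<in>{mu. is_partition mu \<and> mu \<noteq> []}.
              qvar ^ sum_list mu / q_poch (sum_list mu) *
              tvar ^ (length mu - 1) * (1 - tvar) ^ (sum_list mu - length mu) * g_part mu) \<and>
     summable (\<lambda>j. qvar ^ ((j + 1) choose 2) * ((tvar - 1) ^ j / q_poch j)) \<and>
     embed_Qt DC =
       (1 - tvar) / ((\<Sum>j. qvar ^ ((j + 1) choose 2) * ((tvar - 1) ^ j / q_poch j)) - tvar)"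
proof (intro conjI allI impI)
  show "embed_Qt (DC_parts k) = qvar ^ k / q_poch k *
        (\<Sum>lam | is_partition lam \<and> sum_list lam = k.
           tvar ^ (length lam - 1) * (1 - tvar) ^ (k - length lam) * g_part lam)" if "k \<ge> 1" for k
    unfolding qvar_power_div_q_poch sum_distrib_left using that by (rule embed_DC_parts_partitions)
  show "embed_Qt DC = 1 + (\<Sum>\<^sub>\<infinity>mu\<in>{mu. is_partition mu \<and> mu \<noteq> []}.
              qvar ^ sum_list mu / q_poch (sum_list mu) *
              tvar ^ (length mu - 1) * (1 - tvar) ^ (sum_list mu - length mu) * g_part mu)"
    unfolding infsumI[OF has_sum_partitions] by simp
  \<comment> \<open>If the constant term of the denominator were 0, the product formula at q = 0
    would force 1 - t = 0.\<close>
  have "(fps_total euler_term - tvar) $ 0 \<noteq> 0"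
  proof
    assume "(fps_total euler_term - tvar) $ 0 = 0"
    then have "(1 - tvar) $ 0 = 0"
      using arg_cong[OF embed_DC_mult_euler, of "\<lambda>f. f $ 0"] by simp
    moreover have "(1 :: Qt) \<noteq> to_fract [:0, 1:]"
      by (metis to_fract_1 to_fract_eq_iff one_pCons pCons_eq_iff zero_neq_one)
    ultimately show False
      by (simp add: tvar_def)
  qed
  then show "embed_Qt DC =
       (1 - tvar) / ((\<Sum>j. qvar ^ ((j + 1) choose 2) * ((tvar - 1) ^ j / q_poch j)) - tvar)"
    unfolding sums_unique[OF euler_term_sums, symmetric]
    by (intro fps_divide_eqI[symmetric] embed_DC_mult_euler)
qed (rule DC_parts_0 has_sum_imp_summable[OF has_sum_partitions] sums_summable[OF euler_term_sums])+

end
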